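(* For any real number $d$ with $1 \leq d < 2$ there is a compact set $K^d \subset \mathbb{R}^2$ such that $\dim_{\rm H}(K^d) = \underline{\dim}_{\rm box}(K^d) = 0$ and \[ \lim_{\epsilon \downarrow 0} N(K^d,\epsilon)\,\epsilon^d = 0 , \] but $K^d$ can not be covered by a countable collection of $\frac{1}{d}$-Hölder curves, i.e. there is no countable family of $\frac1d$-Hölder maps $f_i : [0,1] \to \mathbb{R}^2$, $i \in \mathbb{N}$, with $K^d \subset \bigcup_{i \in \mathbb{N}} f_i([0,1])$.
   Context: For a bounded set $S \subset \mathbb{R}^2$ and $\epsilon > 0$, $N(S,\epsilon)$ denotes the minimal number of balls of radius $\epsilon$ needed to cover $S$. The lower box-counting dimension of $S$ is \[ \underline{\dim}_{\rm box}(S) := \liminf_{\epsilon \downarrow 0} \frac{\log N(S,\epsilon)}{-\log \epsilon} . \] $\dim_{\rm H}$ denotes Hausdorff dimension. For $0 < \alpha \leq 1$, a map $f : [0,1] \to \mathbb{R}^2$ is $\alpha$-Hölder (an $\alpha$-Hölder curve) if there is a constant $L \geq 0$ with $|f(s)-f(t)| \leq L|s-t|^\alpha$ for all $s,t \in [0,1]$. Different curves of a collection may have different constants $L$. *)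

theory Defs
  imports "HOL-Analysis.Analysis"
begin

text \<open>Closed balls, with centres anywhere in the space. Only meaningful for totally bounded \<open>S\<close>
  and \<open>\<epsilon> > 0\<close>; otherwise there may be no finite cover and \<open>LEAST\<close> is unspecified.\<close>

definition covering_number :: "'a::metric_space set \<Rightarrow> real \<Rightarrow> nat" where
  "covering_number S \<epsilon> =
     (LEAST n. \<exists>C. finite C \<and> card C = n \<and> S \<subseteq> (\<Union>x\<in>C. cball x \<epsilon>))"

text \<open>Intended for bounded nonempty \<open>S\<close>. (For \<open>S = {}\<close> the convention \<open>ln 0 = 0\<close> yields \<open>0\<close>.)\<close>

definition lower_box_dim :: "'a::metric_space set \<Rightarrow> ereal" where
  "lower_box_dim S =
     Liminf (at_right 0) (\<lambda>\<epsilon>. ereal (ln (real (covering_number S \<epsilon>)) / (- ln \<epsilon>)))"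

text \<open>\<open>(diam U)\<^sup>s\<close> with the conventions of Hausdorff measure: the empty set contributes \<open>0\<close>, and
  \<open>(diam U)\<^sup>0 = 1\<close> for every nonempty \<open>U\<close>, whereas \<open>0 powr 0 = 0\<close>.\<close>

definition diam_powr :: "real \<Rightarrow> 'a::metric_space set \<Rightarrow> ennreal" where
  "diam_powr s U =
     (if U = {} then 0 else if s = 0 then 1 else ennreal (diameter U powr s))"

text \<open>\<open>diameter\<close> is real-valued and unspecified on unbounded sets, hence the explicit
  boundedness of the covering sets.\<close>

definition hausdorff_premeasure :: "real \<Rightarrow> real \<Rightarrow> 'a::metric_space set \<Rightarrow> ennreal" where
  "hausdorff_premeasure s \<delta> S =
     Inf {(\<Sum>i. diam_powr s (U i)) | U :: nat \<Rightarrow> 'a set.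
            S \<subseteq> (\<Union>i. U i) \<and> (\<forall>i. bounded (U i) \<and> diameter (U i) \<le> \<delta>)}"

definition hausdorff_measure :: "real \<Rightarrow> 'a::metric_space set \<Rightarrow> ennreal" where
  "hausdorff_measure s S = (SUP \<delta>\<in>{0<..}. hausdorff_premeasure s \<delta> S)"

definition hausdorff_dim :: "'a::metric_space set \<Rightarrow> ereal" where
  "hausdorff_dim S = Inf {ereal s | s. 0 \<le> s \<and> hausdorff_measure s S = 0}"

definition holder_curve :: "real \<Rightarrow> (real \<Rightarrow> 'a::metric_space) \<Rightarrow> bool" where
  "holder_curve \<alpha> f \<longleftrightarrow>
     (\<exists>L\<ge>0. \<forall>s\<in>{0..1}. \<forall>t\<in>{0..1}. dist (f s) (f t) \<le> L * \<bar>s - t\<bar> powr \<alpha>)"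

end

theory Submission
  imports Defs
begin

text \<open>The set \<open>K\<close> is a Cantor-type set in the square: level \<open>n\<close> consists of \<open>P n\<close> squares of side about
  \<open>r n\<close>, and in each of them one picks a square grid of \<open>m n\<close> by \<open>m n\<close> points with spacing
  \<open>\<rho> n = r n / m n\<close>, around which the squares of the next level sit. These are very much smaller than
  the spacing. There are two parameters to choose at each level.

  The side \<open>r n\<close> is taken so small compared with \<open>1 / P n\<close> that the covering by the \<open>P n\<close> squares alone
  makes the lower box dimension \<open>0\<close>. The Hausdorff dimension is dominated by the lower box dimension, so
  it vanishes as well.

  The multiplicity \<open>m n\<close> is taken so that \<open>P (n + 1) * \<rho> n powr d\<close> lies between \<open>1 / (n + 1)\<close> and
  \<open>2 / (n + 1)\<close>. This is possible because \<open>d < 2\<close>: the quantity equals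
  \<open>P n * r n powr d * m n powr (2 - d)\<close>, which is tiny for \<open>m n = 1\<close> and grows slowly and without bound
  with \<open>m n\<close>. Among the scales between \<open>r (n + 1)\<close> and \<open>r n\<close> the scale \<open>\<rho> n\<close> is the worst for
  \<open>N (K, \<epsilon>) * \<epsilon> powr d\<close>, which is therefore \<open>O (1 / n)\<close>.

  A single scale does not obstruct a curve, but the scales add up, since the harmonic series
  diverges. Let a \<open>1 / d\<close>-Hoelder curve with constant \<open>L\<close> visit all points of a deep level inside a fixed
  square. Consider the times of these visits at which the curve enters some square of level \<open>n + 1\<close> for
  the first time. Between the preceding visit and such a time the curve covers a distance of order
  \<open>\<rho> n\<close>, which takes a time of order \<open>(\<rho> n / L) powr d\<close>. These waiting times are disjoint for different
  squares, also for squares of different levels when a time is counted only at the coarsest level where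
  it is a first entry. Of the \<open>P (n + 1)\<close> first entries at least three quarters are new, so the waiting
  times add up to at least a multiple of the harmonic sum, although they all lie in the unit
  interval (\<open>sum_new_classes_le\<close>, \<open>holder_curve_misses_cylinder\<close>). So no single curve covers the part of
  \<open>K\<close> in one of the squares; by Baire's theorem countably many curves do not cover \<open>K\<close>
  (\<open>no_countable_holder_cover\<close>).\<close>

section \<open>First visits and waiting times\<close>

text \<open>Telescoping: \<open>g t\<close> is at most the distance from \<open>t\<close> to its predecessor in \<open>T\<close>. The least element has
  no predecessor and is left out.\<close>

lemma sum_gaps_le:
  fixes T :: "real set" and g :: "real \<Rightarrow> real"
  assumes "finite T" "T \<noteq> {}"
    and "\<And>s t. s \<in> T \<Longrightarrow> t \<in> T \<Longrightarrow> s < t \<Longrightarrow> g t \<le> t - s"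
  shows "sum g (T - {Min T}) \<le> Max T - Min T"
  using assms
proof (induction T rule: finite_linorder_max_induct)
  case empty
  then show ?case by simp
next
  case (insert b A)
  show ?case
  proof (cases "A = {}")
    case True
    then show ?thesis by simp
  next
    case False
    have min: "Min (insert b A) = Min A" and max: "Max (insert b A) = b"
      using insert.hyps False
      by (auto simp: Min_insert Max_insert intro!: min_absorb2 max_absorb1 less_imp_le)
    have split: "insert b A - {Min A} = insert b (A - {Min A})"
      using insert.hyps False by (metis Min_in insert_Diff_if less_irrefl singletonD)
    have "sum g (A - {Min A}) \<le> Max A - Min A"
      using insert False by blast
    moreover have "g b \<le> b - Max A"
      using insert False by simp
    moreover have "sum g (insert b (A - {Min A})) = g b + sum g (A - {Min A})"
      using insert.hyps by (subst sum.insert) auto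
    ultimately show ?thesis
      unfolding min max split by simp
  qed
qed

text \<open>The labels \<open>c k\<close> stand for the square of level \<open>k\<close> visited at a given time, and \<open>\<delta> k\<close> for the time
  needed to change that square. The set \<open>A k\<close> of first visits is in bijection with the squares of level
  \<open>k\<close> and grows with \<open>k\<close>. A time in \<open>A (Suc k) - A k\<close> is preceded by a gap of length \<open>\<delta> (Suc k)\<close>, and
  each time belongs to at most one of these differences, so no gap is counted twice.\<close>

lemma sum_new_classes_le:
  fixes T :: "real set" and c :: "nat \<Rightarrow> real \<Rightarrow> 'b" and \<delta> :: "nat \<Rightarrow> real"
  assumes fin: "finite T" and sub: "T \<subseteq> {0..1}"
    and refine: "\<And>k s t. s \<in> T \<Longrightarrow> t \<in> T \<Longrightarrow> c (Suc k) s = c (Suc k) t \<Longrightarrow> c k s = c k t"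
    and sep: "\<And>k s t. s \<in> T \<Longrightarrow> t \<in> T \<Longrightarrow> c k s \<noteq> c k t \<Longrightarrow> \<delta> k \<le> \<bar>s - t\<bar>"
  shows "(\<Sum>k<M. (real (card (c (Suc k) ` T)) - real (card (c k ` T))) * \<delta> (Suc k)) \<le> 1"
proof (cases "T = {}")
  case True
  then show ?thesis by simp
next
  case False
  define A where "A k = {t \<in> T. \<forall>s\<in>T. s < t \<longrightarrow> c k s \<noteq> c k t}" for k
  define D where "D k = A (Suc k) - A k" for k
  have A_sub: "A k \<subseteq> T" for k by (auto simp: A_def)
  have finA: "finite (A k)" for k using A_sub fin finite_subset by blast
  have "bij_betw (c k) (A k) (c k ` T)" for k
  proof (rule bij_betw_imageI)
    show "inj_on (c k) (A k)"
      by (rule inj_onI) (metis (mono_tags, lifting) A_def linorder_neqE mem_Collect_eq)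
    show "c k ` A k = c k ` T"
    proof
      show "c k ` T \<subseteq> c k ` A k"
      proof
        fix x assume "x \<in> c k ` T"
        define F where "F = {s \<in> T. c k s = x}"
        have F: "finite F" "F \<noteq> {}" using fin \<open>x \<in> c k ` T\<close> by (auto simp: F_def)
        then have "Min F \<in> F" by simp
        have "Min F \<in> A k"
          using \<open>Min F \<in> F\<close> F unfolding A_def
          by (auto simp: F_def)
        moreover have "c k (Min F) = x" using \<open>Min F \<in> F\<close> unfolding F_def by blast
        ultimately show "x \<in> c k ` A k" by blast
      qed
    qed (use A_sub in auto)
  qed
  then have cardA: "card (A k) = card (c k ` T)" for k
    by (rule bij_betw_same_card)
  have A_mono1: "A k \<subseteq> A (Suc k)" for k
    unfolding A_def using refine by blast
  have A_mono: "A j \<subseteq> A k" if "j \<le> k" for j k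
    using A_mono1 that by (rule lift_Suc_mono_le)
  have cardD: "real (card (D k)) = real (card (c (Suc k) ` T)) - real (card (c k ` T))" for k
    unfolding D_def using A_mono1[of k] finA card_mono[OF finA A_mono1]
    by (simp add: card_Diff_subset cardA of_nat_diff)
  have D_sub: "D k \<subseteq> T - {Min T}" for k
    unfolding D_def A_def using fin False by (auto dest: leD[OF Min_le[OF fin]])
  have D_disj: "j = k" if "t \<in> D j" "t \<in> D k" for t j k
    using that A_mono[of "Suc j" k] A_mono[of "Suc k" j]
    by (cases j k rule: linorder_cases) (auto simp: D_def)
  define g where "g t = (\<Sum>k<M. if t \<in> D k then \<delta> (Suc k) else 0)" for t
  have "sum g (T - {Min T}) \<le> Max T - Min T"
  proof (rule sum_gaps_le[OF fin False])
    fix s t assume st: "s \<in> T" "t \<in> T" "s < t"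
    show "g t \<le> t - s"
    proof (cases "\<exists>k<M. t \<in> D k")
      case True
      then obtain k where k: "k < M" "t \<in> D k" by blast
      have "g t = (\<Sum>j<M. if j = k then \<delta> (Suc k) else 0)"
        unfolding g_def using D_disj k by (intro sum.cong) auto
      also have "\<dots> = \<delta> (Suc k)" using k by simp
      also have "\<dots> \<le> \<bar>s - t\<bar>"
        using k st by (intro sep) (auto simp: D_def A_def)
      finally show ?thesis using st by simp
    next
      case False
      then have "g t = 0" by (auto simp: g_def intro!: sum.neutral)
      then show ?thesis using st by simp
    qed
  qed
  also have "\<dots> \<le> 1"
    using subsetD[OF sub Max_in[OF fin False]] subsetD[OF sub Min_in[OF fin False]] by simp
  also have "sum g (T - {Min T}) = (\<Sum>k<M. \<Sum>t\<in>T - {Min T}. if t \<in> D k then \<delta> (Suc k) else 0)"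
    unfolding g_def by (rule sum.swap)
  also have "\<dots> = (\<Sum>k<M. real (card (D k)) * \<delta> (Suc k))"
  proof (rule sum.cong[OF refl])
    fix k
    \<comment> \<open>The very first time is a first visit at every level, hence never new.\<close>
    have "(T - {Min T}) \<inter> {t. t \<in> D k} = D k" using D_sub by blast
    then show "(\<Sum>t\<in>T - {Min T}. if t \<in> D k then \<delta> (Suc k) else 0) = real (card (D k)) * \<delta> (Suc k)"
      using fin by (simp add: sum.If_cases)
  qed
  finally show ?thesis by (simp add: cardD)
qed

section \<open>Hoelder curves\<close>

lemma holder_curve_time_ge:
  fixes x L s t d :: real
  assumes "0 < d" "0 < L" "0 \<le> x"
    and "x \<le> L * \<bar>s - t\<bar> powr (1 / d)"
  shows "(x / L) powr d \<le> \<bar>s - t\<bar>"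
proof -
  have "x / L \<le> \<bar>s - t\<bar> powr (1 / d)"
    using assms(2,4) by (simp add: divide_le_eq mult.commute)
  then have "(x / L) powr d \<le> (\<bar>s - t\<bar> powr (1 / d)) powr d"
    using assms by (intro powr_mono2) auto
  also have "\<dots> = \<bar>s - t\<bar>" using assms(1) by (simp add: powr_powr)
  finally show ?thesis .
qed

lemma holder_curve_continuous:
  fixes f :: "real \<Rightarrow> 'a::metric_space"
  assumes "holder_curve \<alpha> f" "0 < \<alpha>"
  shows "continuous_on {0..1} f"
proof -
  obtain L where L: "\<And>s t. s \<in> {0..1} \<Longrightarrow> t \<in> {0..1} \<Longrightarrow> dist (f s) (f t) \<le> L * \<bar>s - t\<bar> powr \<alpha>"
    using assms(1) unfolding holder_curve_def by blast
  show ?thesis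
    unfolding continuous_on_def
  proof
    fix x :: real assume x: "x \<in> {0..1}"
    show "(f \<longlongrightarrow> f x) (at x within {0..1})"
    proof (rule metric_tendsto_imp_tendsto[of "\<lambda>t. L * \<bar>t - x\<bar> powr \<alpha>" 0])
      have "((\<lambda>t. L * \<bar>t - x\<bar> powr \<alpha>) \<longlongrightarrow> L * \<bar>x - x\<bar> powr \<alpha>) (at x within {0..1})"
        using assms(2) by (intro tendsto_intros tendsto_powr') auto
      then show "((\<lambda>t. L * \<bar>t - x\<bar> powr \<alpha>) \<longlongrightarrow> 0) (at x within {0..1})" by simp
      show "\<forall>\<^sub>F t in at x within {0..1}. dist (f t) (f x) \<le> dist (L * \<bar>t - x\<bar> powr \<alpha>) 0"
        unfolding eventually_at_filter
        using L[OF _ x] by (intro always_eventually) (fastforce intro: order_trans)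
    qed
  qed
qed

section \<open>Covering numbers and Hausdorff dimension\<close>

lemma covering_number_le:
  assumes "finite C" "S \<subseteq> (\<Union>x\<in>C. cball x \<epsilon>)"
  shows "covering_number S \<epsilon> \<le> card C"
  unfolding covering_number_def using assms by (intro Least_le) blast

text \<open>Compactness yields some finite cover, without which the least number would be unspecified.\<close>

lemma covering_number_attained:
  fixes S :: "'a::metric_space set"
  assumes "compact S" "0 < \<epsilon>"
  obtains C where "finite C" "card C = covering_number S \<epsilon>" "S \<subseteq> (\<Union>x\<in>C. cball x \<epsilon>)"
proof -
  obtain C where "finite C" "S \<subseteq> (\<Union>x\<in>C. ball x \<epsilon>)"
    using assms compact_eq_totally_bounded[of S] by meson
  then have "\<exists>n C. finite C \<and> card C = n \<and> S \<subseteq> (\<Union>x\<in>C. cball x \<epsilon>)"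
    by (meson UN_mono ball_subset_cball order_refl order_trans)
  from LeastI_ex[OF this] show ?thesis
    using that unfolding covering_number_def by blast
qed

lemma hausdorff_premeasure_le:
  fixes S :: "'a::metric_space set"
  assumes S: "compact S" and s: "0 < s" and \<epsilon>: "0 < \<epsilon>" "2 * \<epsilon> \<le> \<delta>"
  shows "hausdorff_premeasure s \<delta> S \<le> ennreal (covering_number S \<epsilon> * (2 * \<epsilon>) powr s)"
proof -
  obtain C where C: "finite C" "card C = covering_number S \<epsilon>" "S \<subseteq> (\<Union>x\<in>C. cball x \<epsilon>)"
    using covering_number_attained[OF S \<epsilon>(1)] .
  obtain h where h: "bij_betw h {..<card C} C"
    using ex_bij_betw_nat_finite[OF C(1)] by (auto simp: atLeast0LessThan)
  define U where "U i = (if i < card C then cball (h i) \<epsilon> else {})" for i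
  have diam: "diameter (cball x \<epsilon>) \<le> 2 * \<epsilon>" for x :: 'a
  proof (cases "diameter (cball x \<epsilon>) \<le> 0")
    case True
    then show ?thesis using \<epsilon>(1) by simp
  next
    case False
    show ?thesis
    proof (rule ccontr)
      assume "\<not> ?thesis"
      then obtain y z where "y \<in> cball x \<epsilon>" "z \<in> cball x \<epsilon>" "2 * \<epsilon> < dist y z"
        using diameter_lower_bounded[of "cball x \<epsilon>" "2 * \<epsilon>"] \<epsilon>(1) by auto
      then show False using dist_triangle3[of y z x] by simp
    qed
  qed
  have "S \<subseteq> (\<Union>i. U i)"
  proof
    fix x assume "x \<in> S"
    then obtain c where "c \<in> C" "x \<in> cball c \<epsilon>" using C(3) by blast
    moreover obtain i where "i < card C" "h i = c"
      using bij_betw_imp_surj_on[OF h] \<open>c \<in> C\<close> by (metis imageE lessThan_iff)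
    ultimately show "x \<in> (\<Union>i. U i)" by (intro UN_I[of i]) (auto simp: U_def)
  qed
  moreover have "\<forall>i. bounded (U i) \<and> diameter (U i) \<le> \<delta>"
    using \<epsilon> by (auto simp: U_def intro: order_trans[OF diam])
  ultimately have "hausdorff_premeasure s \<delta> S \<le> (\<Sum>i. diam_powr s (U i))"
    unfolding hausdorff_premeasure_def by (intro Inf_lower) blast
  also have "\<dots> = (\<Sum>i<card C. diam_powr s (U i))"
    by (intro suminf_finite) (auto simp: U_def diam_powr_def)
  also have "\<dots> \<le> (\<Sum>i<card C. ennreal ((2 * \<epsilon>) powr s))"
    using s diameter_ge_0[OF bounded_cball] diam
    by (intro sum_mono) (auto simp: U_def diam_powr_def intro!: ennreal_leI powr_mono2)
  also have "\<dots> = ennreal (card C * (2 * \<epsilon>) powr s)"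
    by (simp add: ennreal_mult ennreal_of_nat_eq_real_of_nat)
  finally show ?thesis by (simp add: C(2))
qed

lemma lower_box_dim_nonneg: "0 \<le> lower_box_dim S"
  unfolding lower_box_dim_def
proof (rule Liminf_bounded)
  have "\<forall>\<^sub>F \<epsilon> in at_right (0::real). \<epsilon> \<in> {0<..<1}"
    by (rule eventually_at_right_real) simp
  then show "\<forall>\<^sub>F \<epsilon> in at_right 0. 0 \<le> ereal (ln (real (covering_number S \<epsilon>)) / (- ln \<epsilon>))"
  proof eventually_elim
    case (elim \<epsilon>)
    have "0 \<le> ln (real n)" for n by (cases n) simp_all
    moreover have "ln \<epsilon> < 0" using elim by simp
    ultimately show ?case
      by (metis divide_nonneg_pos ereal_less_eq(5) neg_0_less_iff_less)
  qed
qed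

lemma hausdorff_dim_nonneg: "0 \<le> hausdorff_dim S"
  unfolding hausdorff_dim_def by (intro Inf_greatest) auto

text \<open>If the lower box dimension is less than \<open>u < s\<close>, then at arbitrarily small scales there is a cover by at
  most \<open>\<epsilon> powr (- u)\<close> balls, which contributes \<open>2 powr s * \<epsilon> powr (s - u)\<close> to the Hausdorff sum.\<close>

theorem hausdorff_dim_le_lower_box_dim:
  assumes S: "compact S"
  shows "hausdorff_dim S \<le> lower_box_dim S"
proof (rule dense_ge)
  fix y assume "lower_box_dim S < y"
  then obtain s where s: "lower_box_dim S < ereal s" "ereal s < y"
    using ereal_dense2 by blast
  then obtain u where u: "lower_box_dim S < ereal u" "ereal u < ereal s"
    using ereal_dense2 by blast
  have "0 \<le> u" using lower_box_dim_nonneg[of S] u(1)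
    by (metis ereal_less_eq(5) less_imp_le order_trans)
  then have "0 < s" "u < s" using u(2) by simp_all
  have "\<not> (\<forall>\<^sub>F \<epsilon> in at_right 0. ereal u \<le> ereal (ln (real (covering_number S \<epsilon>)) / (- ln \<epsilon>)))"
    (is "\<not> ?ev")
  proof
    assume ?ev
    from Liminf_bounded[OF this] u(1) show False unfolding lower_box_dim_def by simp
  qed
  then have freq: "\<exists>\<^sub>F \<epsilon> in at_right 0. ln (real (covering_number S \<epsilon>)) / (- ln \<epsilon>) < u"
    by (simp add: not_eventually not_le)
  have premeasure: "hausdorff_premeasure s \<delta> S = 0" if "0 < \<delta>" for \<delta>
  proof (rule ccontr)
    assume "hausdorff_premeasure s \<delta> S \<noteq> 0"
    then have pos: "0 < hausdorff_premeasure s \<delta> S" by (simp add: zero_less_iff_neq_zero)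
    have "((\<lambda>\<epsilon>. ennreal (2 powr s * \<epsilon> powr (s - u))) \<longlongrightarrow> ennreal (2 powr s * 0 powr (s - u))) (at_right 0)"
      using \<open>u < s\<close> by (intro tendsto_ennrealI tendsto_intros tendsto_powr') (auto simp: eventually_at_filter)
    then have "((\<lambda>\<epsilon>. ennreal (2 powr s * \<epsilon> powr (s - u))) \<longlongrightarrow> 0) (at_right 0)" by simp
    then have "\<forall>\<^sub>F \<epsilon> in at_right 0. ennreal (2 powr s * \<epsilon> powr (s - u)) < hausdorff_premeasure s \<delta> S"
      using pos by (rule order_tendstoD(2))
    moreover have "\<forall>\<^sub>F \<epsilon> in at_right (0::real). \<epsilon> \<in> {0<..<min 1 (\<delta> / 2)}"
      using \<open>0 < \<delta>\<close> by (intro eventually_at_right_real) simp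
    ultimately have "\<forall>\<^sub>F \<epsilon> in at_right 0. u \<le> ln (real (covering_number S \<epsilon>)) / (- ln \<epsilon>)"
    proof eventually_elim
      case (elim \<epsilon>)
      then have \<epsilon>: "0 < \<epsilon>" "\<epsilon> < 1" "2 * \<epsilon> \<le> \<delta>" by auto
      show ?case
      proof (rule ccontr)
        assume "\<not> ?case"
        then have "ln (real (covering_number S \<epsilon>)) / (- ln \<epsilon>) < u" by (rule not_le_imp_less)
        then have ln_less: "ln (real (covering_number S \<epsilon>)) < u * (- ln \<epsilon>)"
          by (subst (asm) pos_divide_less_eq) (use \<epsilon> in simp_all)
        have "real (covering_number S \<epsilon>) \<le> \<epsilon> powr (- u)"
        proof (cases "covering_number S \<epsilon> = 0")
          case False
          then have "real (covering_number S \<epsilon>) = exp (ln (real (covering_number S \<epsilon>)))" by simp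
          also have "\<dots> \<le> exp (u * (- ln \<epsilon>))" using ln_less by (intro exp_le_cancel_iff[THEN iffD2]) simp
          also have "\<dots> = \<epsilon> powr (- u)" using \<epsilon> by (simp add: powr_def)
          finally show ?thesis .
        qed simp
        then have "covering_number S \<epsilon> * (2 * \<epsilon>) powr s \<le> \<epsilon> powr (- u) * (2 * \<epsilon>) powr s"
          by (intro mult_right_mono) auto
        also have "\<dots> = 2 powr s * \<epsilon> powr (s - u)"
          using \<epsilon> by (simp add: powr_mult powr_diff powr_minus field_simps)
        finally have "hausdorff_premeasure s \<delta> S \<le> ennreal (2 powr s * \<epsilon> powr (s - u))"
          using hausdorff_premeasure_le[OF S \<open>0 < s\<close> \<epsilon>(1,3)] ennreal_leI order_trans by blast
        then show False using elim(1) by simp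
      qed
    qed
    then show False using freq by (simp add: frequently_def not_less)
  qed
  have "hausdorff_measure s S = 0"
    unfolding hausdorff_measure_def using premeasure by (simp add: SUP_eq_const)
  then have "hausdorff_dim S \<le> ereal s"
    unfolding hausdorff_dim_def using \<open>0 < s\<close> by (intro Inf_lower) auto
  then show "hausdorff_dim S \<le> y" using s(2) by simp
qed

section \<open>Iterated sparse grids\<close>

lemma restrict_image_PiE:
  assumes "A \<subseteq> A'" and "\<And>x. x \<in> A' \<Longrightarrow> B x \<noteq> {}"
  shows "(\<lambda>w. restrict w A) ` PiE A' B = PiE A B"
proof
  show "(\<lambda>w. restrict w A) ` PiE A' B \<subseteq> PiE A B"
    using assms(1) by (fastforce simp: PiE_iff)
  show "PiE A B \<subseteq> (\<lambda>w. restrict w A) ` PiE A' B"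
  proof
    fix u assume u: "u \<in> PiE A B"
    define b where "b x = (SOME y. y \<in> B x)" for x
    have b: "b x \<in> B x" if "x \<in> A'" for x
      using assms(2)[OF that] unfolding b_def by (simp add: some_in_eq)
    define w where "w = (\<lambda>x\<in>A'. if x \<in> A then u x else b x)"
    have "w \<in> PiE A' B" using u b by (auto simp: w_def PiE_iff)
    moreover have "restrict w A = u"
      using u assms(1) by (auto simp: w_def fun_eq_iff restrict_def PiE_iff extensional_def)
    ultimately show "u \<in> (\<lambda>w. restrict w A) ` PiE A' B" by (metis imageI)
  qed
qed

text \<open>\<open>P n\<close> is the number of squares of level \<open>n\<close>, that is, the product of the \<open>(m k)\<^sup>2\<close> over \<open>k < n\<close>. By
  \<open>r_Suc\<close> squares of one level stay apart, \<open>r_small\<close> makes the lower box dimension \<open>0\<close>, \<open>mass_upper\<close> gives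
  the decay of the covering numbers and \<open>mass_lower\<close> the divergent series that stops Hoelder curves.\<close>

locale sparse_grids =
  fixes d :: real and r :: "nat \<Rightarrow> real" and m P :: "nat \<Rightarrow> nat"
  assumes d_ge: "1 \<le> d" and d_less: "d < 2"
    and r_pos: "0 < r n"
    and m_ge: "2 \<le> m n"
    and r_Suc: "4 * r (Suc n) \<le> r n / m n"
    and P_0: "P 0 = 1"
    and P_Suc: "P (Suc n) = P n * (m n)\<^sup>2"
    and r_less: "8 * r n < 1"
    and r_small: "8 * r n * real (P n) ^ Suc n \<le> 1"
    and mass_lower: "1 / Suc n \<le> P (Suc n) * (r n / m n) powr d"
    and mass_upper: "P (Suc n) * (r n / m n) powr d \<le> 2 / Suc n"
begin

definition \<rho> :: "nat \<Rightarrow> real" where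
  "\<rho> n = r n / m n"

definition point :: "nat \<Rightarrow> (nat \<times> 2 \<Rightarrow> nat) \<Rightarrow> real ^ 2" where
  "point n w = (\<chi> c. \<Sum>k<n. \<rho> k * real (w (k, c)))"

text \<open>A word lists digits: \<open>w (k, c)\<close> is the index, in coordinate \<open>c\<close>, of the grid point chosen at level \<open>k\<close>.
  Extensionality makes a word of length \<open>n\<close> determined by its digits below \<open>n\<close>, so that words can be
  counted.\<close>

definition words :: "nat \<Rightarrow> (nat \<times> 2 \<Rightarrow> nat) set" where
  "words n = PiE ({..<n} \<times> UNIV) (\<lambda>(k, c). {..<m k})"

definition K :: "(real ^ 2) set" where
  "K = closure (\<Union>n. point n ` words n)"

lemma m_pos: "0 < m n"
  using m_ge[of n] by simp

lemma \<rho>_pos: "0 < \<rho> n"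
  by (simp add: \<rho>_def r_pos m_pos)

lemma \<rho>_le_r: "\<rho> n \<le> r n / 2"
  unfolding \<rho>_def using m_ge[of n] r_pos[of n] by (intro divide_left_mono) auto

lemma r_Suc_le: "r (Suc n) \<le> r n / 2"
  using r_Suc[of n] \<rho>_le_r[of n] r_pos[of n] r_pos[of "Suc n"] unfolding \<rho>_def by linarith

lemma r_Suc_le_\<rho>: "4 * r (Suc n) \<le> \<rho> n"
  using r_Suc[of n] by (simp add: \<rho>_def)

lemma decseq_\<rho>: "j \<le> k \<Longrightarrow> \<rho> k \<le> \<rho> j"
proof (rule lift_Suc_antimono_le[of \<rho>])
  show "\<rho> (Suc n) \<le> \<rho> n" for n
    using r_Suc_le_\<rho>[of n] \<rho>_le_r[of "Suc n"] r_pos[of "Suc n"] by linarith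
qed

lemma P_pos: "0 < P n"
  by (induction n) (auto simp: P_0 P_Suc m_pos)

lemma r_le: "r n \<le> r 0 * (1 / 2) ^ n"
proof (induction n)
  case (Suc n)
  then show ?case using r_Suc_le[of n] by simp
qed simp

lemma r_tendsto_0: "r \<longlonglongrightarrow> 0"
proof (rule tendsto_sandwich[OF _ _ tendsto_const])
  show "\<forall>\<^sub>F n in sequentially. 0 \<le> r n" using r_pos by (simp add: less_imp_le)
  show "\<forall>\<^sub>F n in sequentially. r n \<le> r 0 * (1 / 2) ^ n" using r_le by (intro always_eventually) simp
  show "(\<lambda>n. r 0 * (1 / 2) ^ n) \<longlonglongrightarrow> 0"
    by (intro tendsto_mult_right_zero LIMSEQ_power_zero) simp
qed

text \<open>The sides decrease at least geometrically. The subtracted term is what makes the induction on \<open>N\<close> work.\<close>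

lemma sum_r_le: "n \<le> N \<Longrightarrow> (\<Sum>k\<in>{n..<N}. r k) \<le> 2 * r n - 2 * r N"
proof (induction N rule: dec_induct)
  case (step N)
  then show ?case using r_Suc_le[of N] by simp
qed simp

lemma finite_words: "finite (words n)"
  unfolding words_def by (intro finite_PiE) auto

lemma card_words: "card (words n) = P n"
proof -
  have "card (words n) = (\<Prod>(k, c)\<in>{..<n} \<times> (UNIV :: 2 set). m k)"
    unfolding words_def by (subst card_PiE) (auto intro!: prod.cong)
  also have "\<dots> = (\<Prod>k<n. (m k)\<^sup>2)"
    by (subst prod.cartesian_product[symmetric]) simp
  also have "\<dots> = P n"
    by (induction n) (auto simp: P_0 P_Suc)
  finally show ?thesis .
qed

lemma digit_less: "w \<in> words n \<Longrightarrow> k < n \<Longrightarrow> w (k, c) < m k"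
  unfolding words_def by (auto simp: PiE_iff)

lemma digit_contribution:
  assumes "w \<in> words n" "k < n"
  shows "0 \<le> \<rho> k * real (w (k, c))" "\<rho> k * real (w (k, c)) \<le> r k"
proof -
  show "0 \<le> \<rho> k * real (w (k, c))" using \<rho>_pos[of k] by simp
  have "\<rho> k * real (w (k, c)) \<le> \<rho> k * m k"
    using digit_less[OF assms, of c] \<rho>_pos[of k] by (intro mult_left_mono) auto
  then show "\<rho> k * real (w (k, c)) \<le> r k"
    using m_pos[of k] by (simp add: \<rho>_def)
qed

lemma tail_bounds:
  assumes "w \<in> words N" "n \<le> N"
  shows "0 \<le> (\<Sum>k\<in>{n..<N}. \<rho> k * real (w (k, c)))"
    "(\<Sum>k\<in>{n..<N}. \<rho> k * real (w (k, c))) \<le> 2 * r n"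
proof -
  show "0 \<le> (\<Sum>k\<in>{n..<N}. \<rho> k * real (w (k, c)))"
    using digit_contribution(1)[OF assms(1)] by (intro sum_nonneg) auto
  have "(\<Sum>k\<in>{n..<N}. \<rho> k * real (w (k, c))) \<le> (\<Sum>k\<in>{n..<N}. r k)"
    using digit_contribution(2)[OF assms(1)] by (intro sum_mono) auto
  also have "\<dots> \<le> 2 * r n"
    using sum_r_le[OF assms(2)] r_pos[of N] by linarith
  finally show "(\<Sum>k\<in>{n..<N}. \<rho> k * real (w (k, c))) \<le> 2 * r n" .
qed

lemma point_split:
  assumes "n \<le> N"
  shows "point N w $ c = point n w $ c + (\<Sum>k\<in>{n..<N}. \<rho> k * real (w (k, c)))"
  using sum.atLeastLessThan_concat[OF _ assms, of 0 "\<lambda>k. \<rho> k * real (w (k, c))"]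
  by (simp add: point_def lessThan_atLeast0)

lemma point_cong:
  assumes "\<And>k c. k < n \<Longrightarrow> w (k, c) = w' (k, c)"
  shows "point n w = point n w'"
  unfolding point_def using assms by (simp add: vec_eq_iff)

lemma restrict_words:
  assumes "w \<in> words N" "n \<le> N"
  shows "restrict w ({..<n} \<times> UNIV) \<in> words n"
  unfolding words_def using digit_less[OF assms(1)] assms(2) by (intro restrict_PiE_iff[THEN iffD2]) auto

text \<open>Padding with the digit \<open>0\<close> shows that the finite grids increase.\<close>

lemma zero_extension:
  assumes "w \<in> words n" "n \<le> N"
  obtains w' where "w' \<in> words N" "\<And>k c. k < n \<Longrightarrow> w' (k, c) = w (k, c)"
    and "point N w' = point n w"
proof
  define w' where "w' = (\<lambda>(k, c). if k < n then w (k, c) else if k < N then 0 else undefined)"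
  show "w' \<in> words N"
    unfolding words_def
  proof (rule PiE_I)
    fix x :: "nat \<times> 2" assume "x \<in> {..<N} \<times> UNIV"
    then show "w' x \<in> (case x of (k, c) \<Rightarrow> {..<m k})"
      using digit_less[OF assms(1)] m_pos by (cases x) (auto simp: w'_def)
  next
    fix x :: "nat \<times> 2" assume "x \<notin> {..<N} \<times> UNIV"
    then show "w' x = undefined" using assms(2) by (cases x) (auto simp: w'_def)
  qed
  show eq: "w' (k, c) = w (k, c)" if "k < n" for k c using that by (simp add: w'_def)
  have "(\<Sum>k\<in>{n..<N}. \<rho> k * real (w' (k, c))) = 0" for c
    by (intro sum.neutral) (auto simp: w'_def)
  then show "point N w' = point n w"
    using point_split[OF assms(2), of w'] point_cong[of n w' w, OF eq] by (simp add: vec_eq_iff)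
qed

lemma point_mem_box:
  assumes "w \<in> words N" "n \<le> N"
  shows "point N w \<in> cbox (point n w) (point n w + vec (2 * r n))"
  using tail_bounds[OF assms] point_split[OF assms(2), of w] by (simp add: mem_box_cart)

lemma K_subset_boxes: "K \<subseteq> (\<Union>p\<in>point n ` words n. cbox p (p + vec (2 * r n)))"
  unfolding K_def
proof (rule closure_minimal)
  show "closed (\<Union>p\<in>point n ` words n. cbox p (p + vec (2 * r n)))"
    using finite_words by (intro closed_UN) auto
  have "point N w \<in> (\<Union>p\<in>point n ` words n. cbox p (p + vec (2 * r n)))" if w: "w \<in> words N" for N w
  proof (cases "n \<le> N")
    case True
    have "point n (restrict w ({..<n} \<times> UNIV)) = point n w" by (rule point_cong) auto
    then have "point n w \<in> point n ` words n"
      using restrict_words[OF w True] by (metis imageI)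
    then show ?thesis using point_mem_box[OF w True] by blast
  next
    case False
    then obtain w' where "w' \<in> words n" "point n w' = point N w"
      using zero_extension[OF w, of n] by (metis nat_le_linear)
    moreover have "point N w \<in> cbox (point N w) (point N w + vec (2 * r n))"
      using r_pos[of n] by (simp add: mem_box_cart less_imp_le)
    ultimately show ?thesis by (intro UN_I[of "point N w"]) (auto intro: rev_image_eqI)
  qed
  then show "(\<Union>N. point N ` words N) \<subseteq> (\<Union>p\<in>point n ` words n. cbox p (p + vec (2 * r n)))"
    by (intro UN_least image_subsetI)
qed

lemma compact_K: "compact K"
proof -
  have "bounded (\<Union>p\<in>point 0 ` words 0. cbox p (p + vec (2 * r 0)))"
    using finite_words by (intro bounded_UN) auto
  then have "bounded K" using K_subset_boxes[of 0] by (rule bounded_subset)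
  moreover have "closed K" by (simp add: K_def)
  ultimately show ?thesis by (simp add: compact_eq_bounded_closed)
qed

lemma point_mem_K: "w \<in> words n \<Longrightarrow> point n w \<in> K"
  unfolding K_def by (rule subsetD[OF closure_subset]) blast

text \<open>At the first differing digit \<open>j\<close> the points are at least \<open>\<rho> j\<close> apart, and all later digits together
  move each of them by at most \<open>2 * r (Suc j)\<close>, in the same direction, which recovers at most half of that.\<close>

lemma dist_point_ge:
  assumes w: "w \<in> words N" "w' \<in> words N" and j: "j < N" "w (j, c) \<noteq> w' (j, c)"
    and eq: "\<And>i. i < j \<Longrightarrow> w (i, c) = w' (i, c)"
  shows "\<rho> j / 2 \<le> dist (point N w) (point N w')"
proof -
  let ?t = "\<lambda>u. \<Sum>k\<in>{Suc j..<N}. \<rho> k * real (u (k, c))"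
  have split: "point N u $ c = (\<Sum>k<j. \<rho> k * real (u (k, c))) + \<rho> j * real (u (j, c)) + ?t u" for u
    using point_split[of "Suc j" N u c] j(1) by (simp add: point_def)
  have "(\<Sum>k<j. \<rho> k * real (w (k, c))) = (\<Sum>k<j. \<rho> k * real (w' (k, c)))"
    using eq by simp
  then have diff: "point N w $ c - point N w' $ c
      = \<rho> j * (real (w (j, c)) - real (w' (j, c))) + (?t w - ?t w')"
    by (simp add: split algebra_simps)
  have "\<bar>?t w - ?t w'\<bar> \<le> 2 * r (Suc j)"
    using tail_bounds[OF w(1), of "Suc j" c] tail_bounds[OF w(2), of "Suc j" c] j(1) by simp
  also have "\<dots> \<le> \<rho> j / 2" using r_Suc_le_\<rho>[of j] by simp
  finally have t: "\<bar>?t w - ?t w'\<bar> \<le> \<rho> j / 2" .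
  have "1 \<le> \<bar>real (w (j, c)) - real (w' (j, c))\<bar>" using j(2) by linarith
  then have "\<rho> j \<le> \<bar>\<rho> j * (real (w (j, c)) - real (w' (j, c)))\<bar>"
    using \<rho>_pos[of j] by (simp add: abs_mult)
  then have "\<rho> j / 2 \<le> \<bar>(point N w - point N w') $ c\<bar>"
    using t unfolding vector_minus_component diff by linarith
  also have "\<dots> \<le> dist (point N w) (point N w')"
    unfolding dist_norm by (rule component_le_norm_cart)
  finally show ?thesis .
qed

lemma dist_point_ge_of_prefix:
  assumes w: "w \<in> words N" "w' \<in> words N"
    and neq: "restrict w ({..<k} \<times> UNIV) \<noteq> restrict w' ({..<k} \<times> UNIV)"
  shows "\<rho> (k - 1) / 2 \<le> dist (point N w) (point N w')"
proof -
  have "\<exists>j<k. \<exists>c. w (j, c) \<noteq> w' (j, c)"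
    using neq by (auto simp: restrict_def fun_eq_iff split: if_splits)
  then obtain j0 where j0: "j0 < k" "\<exists>c. w (j0, c) \<noteq> w' (j0, c)" by blast
  define j where "j = (LEAST j. \<exists>c. w (j, c) \<noteq> w' (j, c))"
  have j: "\<exists>c. w (j, c) \<noteq> w' (j, c)"
    unfolding j_def by (rule LeastI[of _ j0]) (rule j0(2))
  have "j < k"
    using Least_le[of "\<lambda>j. \<exists>c. w (j, c) \<noteq> w' (j, c)", OF j0(2)] j0(1) unfolding j_def by linarith
  have min: "w (i, c) = w' (i, c)" if "i < j" for i c
    using not_less_Least[of i "\<lambda>j. \<exists>c. w (j, c) \<noteq> w' (j, c)"] that unfolding j_def by blast
  obtain c where c: "w (j, c) \<noteq> w' (j, c)" using j by blast
  have "j < N"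
  proof (rule ccontr)
    assume "\<not> j < N"
    then have "w (j, c) = undefined" "w' (j, c) = undefined"
      using w unfolding words_def by (auto simp: PiE_def extensional_def)
    then show False using c by simp
  qed
  have "\<rho> (k - 1) / 2 \<le> \<rho> j / 2" using \<open>j < k\<close> decseq_\<rho>[of j "k - 1"] by simp
  also have "\<dots> \<le> dist (point N w) (point N w')"
    by (rule dist_point_ge[OF w \<open>j < N\<close> c min])
  finally show ?thesis .
qed

lemma inj_on_point: "inj_on (point N) (words N)"
proof (rule inj_onI)
  fix w w' assume w: "w \<in> words N" "w' \<in> words N" "point N w = point N w'"
  have "restrict w ({..<N} \<times> UNIV) = restrict w' ({..<N} \<times> UNIV)"
    using dist_point_ge_of_prefix[OF w(1,2), of N] w(3) \<rho>_pos[of "N - 1"] by fastforce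
  then show "w = w'" using w unfolding words_def by (metis PiE_restrict)
qed

end

section \<open>Covering numbers of the iterated grids\<close>

context sparse_grids
begin

text \<open>Cut each square of level \<open>n\<close>, of side \<open>2 * r n\<close>, into squares of side \<open>\<epsilon> / 2\<close>. For large \<open>\<epsilon>\<close> one
  centre per square of level \<open>n\<close> remains, so this one estimate serves on both sides of \<open>r n\<close>.\<close>

lemma covering_number_K_le:
  assumes "0 < \<epsilon>"
  shows "covering_number K \<epsilon> \<le> P n * (nat \<lfloor>4 * r n / \<epsilon>\<rfloor> + 1)\<^sup>2"
proof -
  define M where "M = nat \<lfloor>4 * r n / \<epsilon>\<rfloor>"
  define g where "g p i = p + (\<chi> c. \<epsilon> / 2 * real (i c))" for p :: "real ^ 2" and i :: "2 \<Rightarrow> nat"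
  define C where "C = (\<lambda>(p, i). g p i) ` (point n ` words n \<times> (UNIV \<rightarrow>\<^sub>E {..M}))"
  have fin: "finite (point n ` words n \<times> ((UNIV :: 2 set) \<rightarrow>\<^sub>E {..M}))"
    using finite_words by (intro finite_cartesian_product finite_PiE) auto
  have "K \<subseteq> (\<Union>x\<in>C. cball x \<epsilon>)"
  proof
    fix x assume "x \<in> K"
    then obtain p where p: "p \<in> point n ` words n" "x \<in> cbox p (p + vec (2 * r n))"
      using K_subset_boxes by blast
    define i where "i c = nat \<lfloor>(x $ c - p $ c) / (\<epsilon> / 2)\<rfloor>" for c
    have x: "0 \<le> x $ c - p $ c" "x $ c - p $ c \<le> 2 * r n" for c
      using p(2) by (auto simp: mem_box_cart algebra_simps)
    have "i c \<le> M" for c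
    proof -
      have "(x $ c - p $ c) / (\<epsilon> / 2) \<le> 2 * r n / (\<epsilon> / 2)"
        using x[of c] assms by (intro divide_right_mono) auto
      also have "\<dots> = 4 * r n / \<epsilon>" by simp
      finally show ?thesis unfolding i_def M_def by (intro nat_mono floor_mono)
    qed
    then have "g p i \<in> C"
      using p(1) unfolding C_def by (intro image_eqI[of _ _ "(p, i)"]) (auto simp: PiE_iff)
    moreover have close: "\<bar>(x - g p i) $ c\<bar> \<le> \<epsilon> / 2" for c
    proof -
      let ?y = "(x $ c - p $ c) / (\<epsilon> / 2)"
      have "0 \<le> ?y" using x(1)[of c] assms by simp
      then have "real (i c) \<le> ?y" "?y \<le> real (i c) + 1"
        unfolding i_def by linarith+
      then have "\<epsilon> / 2 * real (i c) \<le> x $ c - p $ c" "x $ c - p $ c \<le> \<epsilon> / 2 * real (i c) + \<epsilon> / 2"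
        using assms by (auto simp: field_simps)
      then show ?thesis by (simp add: g_def)
    qed
    have "norm (x - g p i) \<le> \<epsilon>"
      using norm_le_l1_cart[of "x - g p i"] close[of 1] close[of 2] by (simp add: sum_2)
    then have "x \<in> cball (g p i) \<epsilon>" by (simp add: dist_norm norm_minus_commute)
    ultimately show "x \<in> (\<Union>x\<in>C. cball x \<epsilon>)" by blast
  qed
  moreover have "finite C" using fin by (simp add: C_def)
  ultimately have "covering_number K \<epsilon> \<le> card C" by (intro covering_number_le)
  also have "\<dots> \<le> card (point n ` words n \<times> ((UNIV :: 2 set) \<rightarrow>\<^sub>E {..M}))"
    unfolding C_def by (rule card_image_le[OF fin])
  also have "\<dots> = card (point n ` words n) * (M + 1)\<^sup>2"
    by (simp add: card_cartesian_product card_PiE)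
  also have "\<dots> \<le> P n * (M + 1)\<^sup>2"
    using card_image_le[OF finite_words, of "point n" n] by (simp add: card_words)
  finally show ?thesis unfolding M_def .
qed

lemma covering_number_K_coarse: "4 * r n < \<epsilon> \<Longrightarrow> covering_number K \<epsilon> \<le> P n"
proof -
  assume \<epsilon>: "4 * r n < \<epsilon>"
  then have "0 < \<epsilon>" using r_pos[of n] by linarith
  moreover have "\<lfloor>4 * r n / \<epsilon>\<rfloor> \<le> 0" using \<epsilon> \<open>0 < \<epsilon>\<close> by (simp add: floor_le_iff)
  ultimately show ?thesis using covering_number_K_le[of \<epsilon> n] by simp
qed

lemma covering_number_K_fine:
  assumes "0 < \<epsilon>" "\<epsilon> \<le> 4 * r n"
  shows "real (covering_number K \<epsilon>) \<le> 64 * P n * (r n / \<epsilon>)\<^sup>2"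
proof -
  have "real (nat \<lfloor>4 * r n / \<epsilon>\<rfloor> + 1) \<le> 4 * r n / \<epsilon> + 1"
    using assms r_pos[of n] by simp
  also have "\<dots> \<le> 8 * (r n / \<epsilon>)"
    using assms by (simp add: field_simps)
  finally have "(real (nat \<lfloor>4 * r n / \<epsilon>\<rfloor> + 1))\<^sup>2 \<le> (8 * (r n / \<epsilon>))\<^sup>2"
    by (intro power_mono) auto
  then have "P n * (real (nat \<lfloor>4 * r n / \<epsilon>\<rfloor> + 1))\<^sup>2 \<le> P n * (8 * (r n / \<epsilon>))\<^sup>2"
    by (intro mult_left_mono) auto
  also have "\<dots> = 64 * P n * (r n / \<epsilon>)\<^sup>2" unfolding power_mult_distrib by simp
  finally show ?thesis
    using covering_number_K_le[OF assms(1), of n, folded of_nat_le_iff[where 'a = real]]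
    unfolding of_nat_mult of_nat_power by linarith
qed

text \<open>With \<open>4 * r (Suc n) < \<epsilon> \<le> 4 * r n\<close>, the count of squares of level \<open>Suc n\<close> is good for \<open>\<epsilon> < \<rho> n\<close>, and
  cutting up the squares of level \<open>n\<close> is good for \<open>\<epsilon> \<ge> \<rho> n\<close>. In the first range \<open>\<epsilon> powr d\<close> increases
  and in the second \<open>\<epsilon> powr (d - 2)\<close> decreases, so \<open>\<epsilon> = \<rho> n\<close> is the worst case of both.\<close>

lemma covering_number_K_scaled:
  assumes \<epsilon>: "0 < \<epsilon>" "\<epsilon> \<le> 4 * r N"
  shows "real (covering_number K \<epsilon>) * \<epsilon> powr d \<le> 128 / Suc N"
proof -
  have "\<forall>\<^sub>F j in sequentially. r j < \<epsilon> / 4"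
    using order_tendstoD(2)[OF r_tendsto_0, of "\<epsilon> / 4"] \<epsilon>(1) by simp
  then obtain j0 where "r j0 < \<epsilon> / 4" by (auto simp: eventually_sequentially)
  define j where "j = (LEAST j. 4 * r j < \<epsilon>)"
  have j: "4 * r j < \<epsilon>" unfolding j_def by (rule LeastI[of _ j0]) (use \<open>r j0 < \<epsilon> / 4\<close> in simp)
  have below: "\<epsilon> \<le> 4 * r i" if "i < j" for i
    using not_less_Least[of i "\<lambda>j. 4 * r j < \<epsilon>"] that unfolding j_def by simp
  have "N < j"
  proof (rule ccontr)
    assume "\<not> N < j"
    have "decseq r"
    proof (rule decseq_SucI)
      show "r (Suc i) \<le> r i" for i using r_Suc_le[of i] r_pos[of i] by linarith
    qed
    from decseqD[OF this, of j N] have "r N \<le> r j" using \<open>\<not> N < j\<close> by simp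
    then show False using j \<epsilon>(2) by simp
  qed
  then obtain n where n: "j = Suc n" "N \<le> n" by (cases j) auto
  have "real (covering_number K \<epsilon>) * \<epsilon> powr d \<le> 64 * (P (Suc n) * \<rho> n powr d)"
  proof (cases "\<epsilon> < \<rho> n")
    case True
    have "real (covering_number K \<epsilon>) * \<epsilon> powr d \<le> P (Suc n) * \<rho> n powr d"
      using covering_number_K_coarse[of "Suc n" \<epsilon>] j n(1) True \<epsilon>(1) d_ge
      by (intro mult_mono powr_mono2) auto
    also have "\<dots> \<le> 64 * (P (Suc n) * \<rho> n powr d)" by simp
    finally show ?thesis .
  next
    case False
    have "real (covering_number K \<epsilon>) * \<epsilon> powr d \<le> 64 * P n * (r n / \<epsilon>)\<^sup>2 * \<epsilon> powr d"
      using covering_number_K_fine[OF \<epsilon>(1), of n] below n(1) by (intro mult_right_mono) auto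
    also have "\<dots> = 64 * P n * (r n)\<^sup>2 * \<epsilon> powr (d - 2)"
      using \<epsilon>(1) by (simp add: powr_diff power_divide powr_numeral)
    also have "\<dots> \<le> 64 * P n * (r n)\<^sup>2 * \<rho> n powr (d - 2)"
      using False \<rho>_pos[of n] d_less by (intro mult_left_mono powr_mono2') auto
    also have "\<dots> = 64 * (P (Suc n) * \<rho> n powr d)"
      using \<rho>_pos[of n] m_pos[of n] r_pos[of n]
      by (simp add: powr_diff powr_numeral P_Suc \<rho>_def power_divide)
    finally show ?thesis .
  qed
  also have "\<dots> \<le> 64 * (2 / Suc n)"
    unfolding \<rho>_def by (intro mult_left_mono mass_upper) simp
  also have "\<dots> \<le> 128 / Suc N" using n(2) by (simp add: divide_left_mono)
  finally show ?thesis .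
qed

lemma covering_number_K_limit:
  "((\<lambda>\<epsilon>. real (covering_number K \<epsilon>) * \<epsilon> powr d) \<longlongrightarrow> 0) (at_right 0)"
proof (rule tendstoI)
  fix e :: real assume "0 < e"
  obtain N where N: "128 / e < real (Suc N)" using reals_Archimedean2[of "128 / e"]
    by (metis less_trans lessI of_nat_less_iff)
  then have small: "128 / Suc N < e" using \<open>0 < e\<close> by (simp add: field_simps)
  have "\<forall>\<^sub>F \<epsilon> in at_right (0::real). \<epsilon> \<in> {0<..<4 * r N}"
    using r_pos by (intro eventually_at_right_real) simp
  then show "\<forall>\<^sub>F \<epsilon> in at_right 0. dist (real (covering_number K \<epsilon>) * \<epsilon> powr d) 0 < e"
  proof eventually_elim
    case (elim \<epsilon>)
    then show ?case using covering_number_K_scaled[of \<epsilon> N] small by simp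
  qed
qed

lemma lower_box_dim_K: "lower_box_dim K = 0"
proof (rule antisym[OF _ lower_box_dim_nonneg])
  show "lower_box_dim K \<le> 0"
  proof (rule ccontr)
    assume "\<not> lower_box_dim K \<le> 0"
    then obtain u where u: "0 < u" "ereal u < lower_box_dim K"
      by (metis ereal_dense2 ereal_less(2) not_le)
    then have "\<forall>\<^sub>F \<epsilon> in at_right 0. ereal u < ereal (ln (real (covering_number K \<epsilon>)) / (- ln \<epsilon>))"
      using less_LiminfD unfolding lower_box_dim_def by blast
    then obtain b where b: "0 < b"
      "\<And>\<epsilon>. 0 < \<epsilon> \<Longrightarrow> \<epsilon> < b \<Longrightarrow> u < ln (real (covering_number K \<epsilon>)) / (- ln \<epsilon>)"
      by (auto simp: eventually_at_right_field)
    have "\<forall>\<^sub>F n in sequentially. r n < b / 8 \<and> 1 / u < real n"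
      using order_tendstoD(2)[OF r_tendsto_0, of "b / 8"] b(1)
        filterlim_real_sequentially[unfolded filterlim_at_top_dense, rule_format, of "1 / u"]
      by (auto intro: eventually_conj)
    then obtain n where n: "r n < b / 8" "1 / u < real n" by (auto simp: eventually_sequentially)
    \<comment> \<open>At scale \<open>8 * r n\<close> the \<open>P n\<close> squares suffice and the quotient is at most \<open>1 / Suc n\<close>.\<close>
    have N_ln: "ln (real (covering_number K (8 * r n))) \<le> ln (real (P n))"
    proof (cases "covering_number K (8 * r n) = 0")
      case True
      then show ?thesis using P_pos[of n] by simp
    next
      case False
      then show ?thesis
        using covering_number_K_coarse[of n "8 * r n"] r_pos[of n] P_pos[of n] by simp
    qed
    have P_ln: "real (Suc n) * ln (real (P n)) \<le> - ln (8 * r n)"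
    proof -
      have "ln (8 * r n * real (P n) ^ Suc n) \<le> 0"
        using r_small[of n] r_pos[of n] P_pos[of n] by (intro ln_le_zero_iff[THEN iffD2]) auto
      then show ?thesis
        using r_pos[of n] P_pos[of n] by (simp add: ln_mult ln_realpow del: power_Suc)
    qed
    have neg: "ln (8 * r n) < 0" using r_less[of n] r_pos[of n] by simp
    have "u * (- ln (8 * r n)) < ln (real (covering_number K (8 * r n)))"
    proof (rule pos_less_divide_eq[THEN iffD1])
      show "u < ln (real (covering_number K (8 * r n))) / - ln (8 * r n)"
        using b(2)[of "8 * r n"] n(1) r_pos[of n] by simp
    qed (use neg in simp)
    then have "u * (- ln (8 * r n)) < ln (real (P n))" using N_ln by linarith
    then have "real (Suc n) * (u * (- ln (8 * r n))) < real (Suc n) * ln (real (P n))"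
      by (intro mult_strict_left_mono) simp_all
    also have "\<dots> \<le> 1 * (- ln (8 * r n))" using P_ln by simp
    finally have "(real (Suc n) * u) * (- ln (8 * r n)) < 1 * (- ln (8 * r n))"
      by (simp only: mult.assoc)
    then have "real (Suc n) * u < 1"
      by (rule mult_right_less_imp_less) (use neg in simp)
    moreover have "1 < real (Suc n) * u" using n(2) u(1) by (simp add: field_simps)
    ultimately show False by simp
  qed
qed

end

section \<open>Hoelder curves and the iterated grids\<close>

context sparse_grids
begin

text \<open>A cylinder consists of the points whose first \<open>n\<close> digits are those of \<open>v\<close>. If \<open>f\<close> visited all of them,
  then for every \<open>M\<close> the times of its visits to the points with \<open>n + M\<close> digits, labelled by their first
  \<open>n + k\<close> digits, would satisfy \<open>sum_new_classes_le\<close>. Since \<open>m\<close> is at least \<open>2\<close>, at least three quarters of the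
  classes are new at each level, and \<open>mass_lower\<close> turns the sum into a harmonic one.\<close>

lemma holder_curve_misses_cylinder:
  assumes f: "holder_curve (1 / d) f" and v: "v \<in> words n"
  shows "\<exists>N w. n \<le> N \<and> w \<in> words N \<and> (\<forall>k<n. \<forall>c. w (k, c) = v (k, c)) \<and> point N w \<notin> f ` {0..1}"
proof (rule ccontr)
  assume "\<not> ?thesis"
  then have covered: "point N w \<in> f ` {0..1}"
    if "n \<le> N" "w \<in> words N" "\<And>k c. k < n \<Longrightarrow> w (k, c) = v (k, c)" for N w
    using that by blast
  obtain L0 where "0 \<le> L0"
    and L0: "\<And>s t. s \<in> {0..1} \<Longrightarrow> t \<in> {0..1} \<Longrightarrow> dist (f s) (f t) \<le> L0 * \<bar>s - t\<bar> powr (1 / d)"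
    using f unfolding holder_curve_def by blast
  define L where "L = L0 + 1"
  have "0 < L" using \<open>0 \<le> L0\<close> by (simp add: L_def)
  have L: "dist (f s) (f t) \<le> L * \<bar>s - t\<bar> powr (1 / d)" if "s \<in> {0..1}" "t \<in> {0..1}" for s t
    using L0[OF that] by (simp add: L_def algebra_simps add_increasing)
  \<comment> \<open>Freezing the first \<open>n\<close> digits makes the cylinder a product set, like the set of all words.\<close>
  define B where "B = (\<lambda>(k, c :: 2). if k < n then {v (k, c)} else {..<m k})"
  define A where "A k = {..<n + k} \<times> (UNIV :: 2 set)" for k
  have B_ne: "B x \<noteq> {}" for x using m_pos by (auto simp: B_def split: prod.splits)
  \<comment> \<open>The number of squares of level \<open>n + k\<close> in the cylinder.\<close>
  define Q where "Q k = card (PiE (A k) B)" for k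
  have Q_prod: "Q k = (\<Prod>i<n + k. \<Prod>c\<in>UNIV. card (B (i, c)))" for k
    unfolding Q_def A_def by (subst card_PiE) (auto simp: prod.cartesian_product)
  have Q_0: "Q 0 = 1" unfolding Q_prod by (simp add: B_def)
  have Q_Suc: "Q (Suc k) = Q k * (m (n + k))\<^sup>2" for k
    unfolding Q_prod by (simp add: B_def)
  have Q_P: "P n * Q k = P (n + k)" for k
    by (induction k) (simp_all add: Q_0 Q_Suc P_Suc mult.assoc[symmetric])
  \<comment> \<open>Words that differ below \<open>n + k\<close> give points at distance at least \<open>\<rho> (n + k - 1) / 2\<close>. For
    \<open>k = 0\<close> no such words exist in the cylinder, so the truncated subtraction is harmless.\<close>
  define \<delta> where "\<delta> k = (\<rho> (n + k - 1) / 2 / L) powr d" for k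
  define \<kappa> where "\<kappa> = 3 / (4 * P n * (2 * L) powr d)"
  have "0 < \<kappa>" using P_pos[of n] \<open>0 < L\<close> by (simp add: \<kappa>_def)
  have bound: "(\<Sum>k<M. (real (Q (Suc k)) - real (Q k)) * \<delta> (Suc k)) \<le> 1" for M
  proof -
    define W where "W = PiE (A M) B"
    have W_words: "W \<subseteq> words (n + M)"
      unfolding W_def words_def A_def B_def
      using digit_less[OF v] by (intro PiE_mono) (auto split: if_splits)
    have W_v: "w (k, c) = v (k, c)" if "w \<in> W" "k < n" for w k c
      using that PiE_mem[of w "A M" B "(k, c)"] unfolding W_def by (simp add: A_def B_def)
    have finW: "finite W" using W_words finite_words finite_subset by blast
    have "\<exists>t\<in>{0..1}. f t = point (n + M) w" if "w \<in> W" for w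
      using covered[of "n + M" w] W_words W_v that by fastforce
    then obtain \<tau> where \<tau>: "\<And>w. w \<in> W \<Longrightarrow> \<tau> w \<in> {0..1}"
      "\<And>w. w \<in> W \<Longrightarrow> f (\<tau> w) = point (n + M) w"
      by metis
    have inj: "inj_on \<tau> W"
    proof (rule inj_onI)
      fix w w' assume w: "w \<in> W" "w' \<in> W" "\<tau> w = \<tau> w'"
      then have "point (n + M) w = point (n + M) w'" using \<tau>(2) by metis
      then show "w = w'" using inj_onD[OF inj_on_subset[OF inj_on_point W_words]] w by blast
    qed
    \<comment> \<open>The label of a time is the digit prefix of the point visited then.\<close>
    define c where "c k t = restrict (inv_into W \<tau> t) (A k)" for k t
    have c_\<tau>: "c k (\<tau> w) = restrict w (A k)" if "w \<in> W" for k w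
      using that inj by (simp add: c_def)
    have "(\<Sum>k<M. (real (card (c (Suc k) ` \<tau> ` W)) - real (card (c k ` \<tau> ` W))) * \<delta> (Suc k)) \<le> 1"
    proof (rule sum_new_classes_le)
      show "finite (\<tau> ` W)" using finW by simp
      show "\<tau> ` W \<subseteq> {0..1}" using \<tau>(1) by blast
    next
      fix k s t
      assume "c (Suc k) s = c (Suc k) t"
      then have "restrict (c (Suc k) s) (A k) = restrict (c (Suc k) t) (A k)" by simp
      moreover have "A (Suc k) \<inter> A k = A k" by (auto simp: A_def)
      ultimately show "c k s = c k t" by (simp add: c_def)
    next
      fix k s t
      assume st: "s \<in> \<tau> ` W" "t \<in> \<tau> ` W" "c k s \<noteq> c k t"
      then obtain w w' where w: "w \<in> W" "s = \<tau> w" "w' \<in> W" "t = \<tau> w'" by blast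
      have "\<rho> (n + k - 1) / 2 \<le> dist (f s) (f t)"
        using dist_point_ge_of_prefix[of w "n + M" w' "n + k"] w st(3) W_words \<tau>(2) c_\<tau>
        by (auto simp: A_def)
      also have "\<dots> \<le> L * \<bar>s - t\<bar> powr (1 / d)"
        using L \<tau>(1) w by simp
      finally show "\<delta> k \<le> \<bar>s - t\<bar>"
        unfolding \<delta>_def using d_ge \<open>0 < L\<close> \<rho>_pos[of "n + k - 1"]
        by (intro holder_curve_time_ge) auto
    qed
    moreover have "card (c k ` \<tau> ` W) = Q k" if "k \<le> M" for k
    proof -
      have "c k ` \<tau> ` W = (\<lambda>w. restrict w (A k)) ` PiE (A M) B"
        using c_\<tau> by (auto simp: W_def image_image)
      also have "\<dots> = PiE (A k) B"
        using that B_ne by (intro restrict_image_PiE) (auto simp: A_def)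
      finally show ?thesis by (simp add: Q_def)
    qed
    ultimately show ?thesis by simp
  qed
  have harmonic: "\<kappa> * inverse (of_nat (k + Suc n)) \<le> (real (Q (Suc k)) - real (Q k)) * \<delta> (Suc k)" for k
  proof -
    have "2\<^sup>2 \<le> (m (n + k))\<^sup>2" using m_ge by (intro power_mono) auto
    then have "4 * Q k \<le> Q (Suc k)" by (simp add: Q_Suc mult.commute)
    then have Q4: "3 / 4 * real (Q (Suc k)) \<le> real (Q (Suc k)) - real (Q k)" by linarith
    have QP: "real (Q (Suc k)) = P (Suc (n + k)) / P n"
      using Q_P[of "Suc k"] P_pos[of n] by (simp add: field_simps flip: of_nat_mult)
    have \<delta>: "\<delta> (Suc k) = \<rho> (n + k) powr d / (2 * L) powr d"
      using \<rho>_pos[of "n + k"] \<open>0 < L\<close> by (simp add: \<delta>_def powr_divide)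
    have "\<kappa> * inverse (of_nat (k + Suc n)) = \<kappa> * (1 / Suc (n + k))"
      by (simp add: field_simps)
    also have "\<dots> \<le> \<kappa> * (P (Suc (n + k)) * \<rho> (n + k) powr d)"
      unfolding \<rho>_def using \<open>0 < \<kappa>\<close> by (intro mult_left_mono mass_lower) simp
    also have "\<dots> = 3 / 4 * real (Q (Suc k)) * \<delta> (Suc k)"
      unfolding QP \<delta> \<kappa>_def by (simp add: field_simps)
    also have "\<dots> \<le> (real (Q (Suc k)) - real (Q k)) * \<delta> (Suc k)"
      using Q4 by (intro mult_right_mono) (auto simp: \<delta>_def)
    finally show ?thesis .
  qed
  have "(\<Sum>k<M. \<kappa> * inverse (of_nat (k + Suc n))) \<le> 1" for M
    by (rule order_trans[OF sum_mono bound[of M]]) (rule harmonic)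
  then have "summable (\<lambda>k. \<kappa> * inverse (of_nat (k + Suc n)))"
    using \<open>0 < \<kappa>\<close> by (intro summableI_nonneg_bounded) auto
  then have "summable (\<lambda>k. inverse (of_nat (k + Suc n)) :: real)"
    using \<open>0 < \<kappa>\<close> by (simp add: summable_cmult_iff)
  then have "summable (\<lambda>k. inverse (of_nat k) :: real)"
    by (subst (asm) summable_iff_shift)
  then show False using not_summable_harmonic by blast
qed

text \<open>If countably many curves covered \<open>K\<close>, then by Baire's theorem the image of one of them would contain a
  nonempty relatively open part of \<open>K\<close>, hence a cylinder around one of the dense grid points.\<close>

lemma no_countable_holder_cover:
  assumes f: "\<And>i::nat. holder_curve (1 / d) (f i)" and cover: "K \<subseteq> (\<Union>i. f i ` {0..1})"
  shows False
proof -
  define F where "F i = f i ` {0..1}" for i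
  have "words 0 \<noteq> {}" using card_words[of 0] P_0 by force
  then have "K \<noteq> {}" using point_mem_K by blast
  have "\<exists>i. \<not> K \<subseteq> closure (K - F i)"
  proof (rule ccontr)
    assume dense: "\<not> ?thesis"
    have "K \<subseteq> closure (\<Inter>(range (\<lambda>i. K - F i)))"
    proof (rule Baire)
      show "closed K" using compact_K by (rule compact_imp_closed)
      fix T assume "T \<in> range (\<lambda>i. K - F i)"
      then obtain i where i: "T = K - F i" by blast
      have "continuous_on {0..1} (f i)"
        using holder_curve_continuous[OF f] d_ge by simp
      then have "closed (F i)"
        unfolding F_def by (intro compact_imp_closed compact_continuous_image) simp_all
      then have "openin (top_of_set K) T"
        unfolding i openin_open by (intro exI[of _ "- F i"]) auto
      then show "openin (top_of_set K) T \<and> K \<subseteq> closure T"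
        using dense i by blast
    qed simp
    moreover have empty: "\<Inter>(range (\<lambda>i. K - F i)) = {}"
      using cover unfolding F_def by blast
    ultimately show False using \<open>K \<noteq> {}\<close> unfolding empty by simp
  qed
  then obtain i x where x: "x \<in> K" "x \<notin> closure (K - F i)" by blast
  define U where "U = - closure (K - F i)"
  have U: "open U" "K \<inter> U \<subseteq> F i" using closure_subset[of "K - F i"] by (auto simp: U_def)
  have "U \<inter> (\<Union>n. point n ` words n) \<noteq> {}"
    using x U(1) open_Int_closure_eq_empty[of U "\<Union>n. point n ` words n"]
    by (auto simp: U_def K_def)
  then obtain j u where u: "u \<in> words j" "point j u \<in> U" by blast
  obtain e where e: "0 < e" "ball (point j u) e \<subseteq> U"
    using U(1) u(2) open_contains_ball by blast
  \<comment> \<open>Lengthening the word by zeros keeps the point and shrinks the cylinder until it fits into the ball.\<close>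
  have "\<forall>\<^sub>F n in sequentially. j \<le> n \<and> r n < e / 4"
    using e(1) order_tendstoD(2)[OF r_tendsto_0, of "e / 4"] by (auto intro: eventually_conj eventually_ge_at_top)
  then obtain n where n: "j \<le> n" "r n < e / 4" by (auto simp: eventually_sequentially)
  obtain v where v: "v \<in> words n" "point n v = point j u"
    using zero_extension[OF u(1) n(1)] by metis
  obtain N w where w: "n \<le> N" "w \<in> words N" "\<And>k c. k < n \<Longrightarrow> w (k, c) = v (k, c)"
    and not_in: "point N w \<notin> f i ` {0..1}"
    using holder_curve_misses_cylinder[OF f v(1)] by blast
  have "point n w = point j u" using point_cong[of n w v] w(3) v(2) by simp
  then have "point N w \<in> cbox (point j u) (point j u + vec (2 * r n))"
    using point_mem_box[OF w(2,1)] by simp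
  then have "dist (point j u) (point N w) \<le> 4 * r n"
    using norm_le_l1_cart[of "point N w - point j u"]
    by (simp add: mem_box_cart dist_norm norm_minus_commute sum_2 forall_2)
  then have "point N w \<in> U" using e n(2) by (auto simp: ball_def)
  then have "point N w \<in> F i" using U(2) point_mem_K[OF w(2)] by blast
  then show False using not_in by (simp add: F_def)
qed

end

section \<open>Choice of the scales\<close>

text \<open>The quantity in question is a constant times \<open>m powr (2 - d)\<close>. It is below \<open>c\<close> for \<open>m = 1\<close>, and since
  \<open>0 < 2 - d \<le> 1\<close> it is unbounded in \<open>m\<close> but at most doubles from \<open>m - 1\<close> to \<open>m\<close>. Hence the least \<open>m\<close> for which
  it reaches \<open>c\<close> does not overshoot by more than a factor \<open>2\<close>.\<close>

lemma exists_multiplicity: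
  fixes r d c :: real and P :: nat
  assumes d: "1 \<le> d" "d < 2" and r: "0 < r" "r \<le> 1" and P: "1 \<le> P" and c: "P * r < c"
  shows "\<exists>m::nat. 2 \<le> m \<and> c \<le> real (P * m\<^sup>2) * (r / m) powr d \<and> real (P * m\<^sup>2) * (r / m) powr d \<le> 2 * c"
proof -
  define g where "g m = P * r powr d * real m powr (2 - d)" for m :: nat
  have g_eq: "real (P * m\<^sup>2) * (r / m) powr d = g m" if "0 < m" for m :: nat
    using that r(1) by (simp add: g_def powr_divide powr_diff powr_numeral)
  have "0 < P * r powr d" using P r by simp
  have "0 \<le> P * r" using r(1) by simp
  then have "0 < c" using c by linarith
  define x where "x = c / (P * r powr d)"
  have "0 < x" using \<open>0 < c\<close> \<open>0 < P * r powr d\<close> by (simp add: x_def)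
  obtain m0 :: nat where "x powr (1 / (2 - d)) \<le> m0" using real_arch_simple by blast
  then have "(x powr (1 / (2 - d))) powr (2 - d) \<le> real m0 powr (2 - d)"
    using d(2) by (intro powr_mono2) auto
  then have "x \<le> real m0 powr (2 - d)"
    using d(2) \<open>0 < x\<close> by (simp add: powr_powr)
  then have "c / (P * r powr d) \<le> real m0 powr (2 - d)" by (simp add: x_def)
  then have m0: "c \<le> g m0"
    using \<open>0 < P * r powr d\<close> unfolding g_def by (simp add: divide_le_eq mult.commute)
  define m where "m = (LEAST m. c \<le> g m)"
  have m: "c \<le> g m" unfolding m_def by (rule LeastI[of _ m0]) (rule m0)
  have "g 0 < c" using \<open>0 < c\<close> by (simp add: g_def)
  moreover have "g 1 < c"
  proof -
    have "r powr d \<le> r powr 1" using d(1) r by (intro powr_mono') auto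
    then have "P * r powr d \<le> P * r" using r(1) by (intro mult_left_mono) auto
    then show ?thesis using c by (simp add: g_def)
  qed
  ultimately have "m \<noteq> 0" "m \<noteq> 1" using m by (metis not_le)+
  then have "2 \<le> m" by simp
  have "g (m - 1) < c"
    using not_less_Least[of "m - 1" "\<lambda>m. c \<le> g m"] \<open>2 \<le> m\<close> unfolding m_def[symmetric] by simp
  have "real m \<le> 2 * real (m - 1)" using \<open>2 \<le> m\<close> by simp
  then have "real m powr (2 - d) \<le> (2 * real (m - 1)) powr (2 - d)"
    using d(2) by (intro powr_mono2) auto
  also have "\<dots> = 2 powr (2 - d) * real (m - 1) powr (2 - d)"
    by (simp add: powr_mult)
  also have "\<dots> \<le> 2 powr 1 * real (m - 1) powr (2 - d)"
    using d(1) by (intro mult_right_mono powr_mono) auto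
  finally have "real m powr (2 - d) \<le> 2 * real (m - 1) powr (2 - d)" by simp
  then have "g m \<le> P * r powr d * (2 * real (m - 1) powr (2 - d))"
    unfolding g_def using \<open>0 < P * r powr d\<close> by (intro mult_left_mono) auto
  also have "\<dots> = 2 * g (m - 1)" by (simp add: g_def)
  finally have "g m \<le> 2 * c" using \<open>g (m - 1) < c\<close> by simp
  then show ?thesis using \<open>2 \<le> m\<close> m g_eq[of m] by (intro exI[of _ m]) simp
qed

lemma exists_sparse_grids:
  assumes d: "1 \<le> d" "d < 2"
  shows "\<exists>r m P. sparse_grids d r m P"
proof -
  define good where "good n = (\<lambda>(r :: real, m :: nat, P :: nat). 0 < r \<and> r \<le> 1 \<and> 2 \<le> m \<and> 1 \<le> P \<and>
    8 * r < 1 \<and> 8 * r * real P ^ Suc n \<le> 1 \<and>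
    1 / Suc n \<le> real (P * m\<^sup>2) * (r / m) powr d \<and> real (P * m\<^sup>2) * (r / m) powr d \<le> 2 / Suc n)" for n
  have step: "\<exists>r m. good n (r, m, P) \<and> 4 * r \<le> \<rho>" if \<rho>: "0 < \<rho>" "\<rho> \<le> 1" and P: "1 \<le> P" for n P \<rho>
  proof -
    \<comment> \<open>Dividing the previous spacing by all relevant quantities at once makes every condition on \<open>r\<close> hold.\<close>
    define r where "r = \<rho> / (16 * (Suc n * real P ^ Suc n))"
    have large: "1 \<le> Suc n * real P ^ Suc n"
      using P by (intro mult_ge1_I one_le_power) auto
    have "0 < r" using \<rho>(1) P by (simp add: r_def)
    have r_eq: "r * (Suc n * real P ^ Suc n) = \<rho> / 16"
      using P large by (simp add: r_def field_simps)
    have r_le: "r * x \<le> \<rho> / 16" if "x \<le> Suc n * real P ^ Suc n" for x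
      using mult_left_mono[OF that less_imp_le[OF \<open>0 < r\<close>]] unfolding r_eq .
    have "r \<le> \<rho> / 16" using r_le[OF large] by simp
    have "r * real P ^ Suc n \<le> \<rho> / 16"
      by (intro r_le) (simp add: distrib_right)
    have "real P * 1 \<le> real P * real P ^ n" using P by (intro mult_left_mono one_le_power) auto
    then have "Suc n * real P \<le> Suc n * real P ^ Suc n" by (intro mult_left_mono) auto
    then have "r * (Suc n * real P) \<le> \<rho> / 16" by (rule r_le)
    then have "r * (Suc n * real P) < 1" using \<rho>(2) by linarith
    then have "real P * r * Suc n < 1" by (simp only: mult_ac)
    then have "real P * r < 1 / Suc n" by (simp only: pos_less_divide_eq of_nat_0_less_iff zero_less_Suc)
    then obtain m where "2 \<le> m" "1 / Suc n \<le> real (P * m\<^sup>2) * (r / m) powr d"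
      "real (P * m\<^sup>2) * (r / m) powr d \<le> 2 * (1 / Suc n)"
      using exists_multiplicity[OF d \<open>0 < r\<close> _ P] \<open>r \<le> \<rho> / 16\<close> \<rho>(2) by force
    then show ?thesis
      using \<open>0 < r\<close> \<open>r \<le> \<rho> / 16\<close> \<open>r * real P ^ Suc n \<le> \<rho> / 16\<close> \<rho> P
      unfolding good_def by (intro exI[of _ r] exI[of _ m]) auto
  qed
  define next_to where "next_to = (\<lambda>(r :: real, m :: nat, P :: nat) (r', m' :: nat, P'). 4 * r' \<le> r / m \<and> P' = P * m\<^sup>2)"
  have "\<exists>f. \<forall>n. (good n (f n) \<and> (n = 0 \<longrightarrow> snd (snd (f n)) = 1)) \<and> next_to (f n) (f (Suc n))"
  proof (rule dependent_nat_choice)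
    show "\<exists>x. good 0 x \<and> (0 = 0 \<longrightarrow> snd (snd x) = (1 :: nat))"
      using step[of 1 1 0] by auto
  next
    fix x n assume x: "good n x \<and> (n = 0 \<longrightarrow> snd (snd x) = (1 :: nat))"
    obtain r m P where x_eq: "x = (r, m, P)" by (cases x)
    have *: "0 < r / m" "r / m \<le> 1" "1 \<le> P * m\<^sup>2"
      using x unfolding x_eq good_def by (auto simp: divide_le_eq)
    from step[OF *] show "\<exists>y. (good (Suc n) y \<and> (Suc n = 0 \<longrightarrow> snd (snd y) = 1)) \<and>
      next_to x y"
      unfolding x_eq next_to_def by auto
  qed
  then obtain f where f0: "\<forall>n. (good n (f n) \<and> (n = 0 \<longrightarrow> snd (snd (f n)) = 1)) \<and> next_to (f n) (f (Suc n))" ..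
  have f: "good n (f n)" "snd (snd (f 0)) = 1" "next_to (f n) (f (Suc n))" for n
    using f0 by simp_all
  have "sparse_grids d (\<lambda>n. fst (f n)) (\<lambda>n. fst (snd (f n))) (\<lambda>n. snd (snd (f n)))"
  proof
    fix n
    show "1 \<le> d" "d < 2" by (fact d)+
    note gn = f(1)[of n, unfolded good_def case_prod_beta]
    note sn = f(3)[of n, unfolded next_to_def case_prod_beta]
    show "0 < fst (f n)" "2 \<le> fst (snd (f n))" "8 * fst (f n) < 1"
      "8 * fst (f n) * real (snd (snd (f n))) ^ Suc n \<le> 1"
      using gn by blast+
    show "4 * fst (f (Suc n)) \<le> fst (f n) / real (fst (snd (f n)))"
      and P: "snd (snd (f (Suc n))) = snd (snd (f n)) * (fst (snd (f n)))\<^sup>2"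
      using sn by blast+
    show "snd (snd (f 0)) = 1" by (fact f(2))
    show "1 / Suc n \<le> real (snd (snd (f (Suc n)))) * (fst (f n) / real (fst (snd (f n)))) powr d"
      "real (snd (snd (f (Suc n)))) * (fst (f n) / real (fst (snd (f n)))) powr d \<le> 2 / Suc n"
      unfolding P using gn by blast+
  qed
  then show ?thesis by blast
qed

section \<open>A small compact set that no countable family of Hoelder curves covers\<close>

theorem theorem1p4:
  fixes d :: real
  assumes "1 \<le> d" and "d < 2"
  shows "\<exists>K :: (real ^ 2) set.
           compact K \<and>
           hausdorff_dim K = 0 \<and>
           lower_box_dim K = 0 \<and>
           ((\<lambda>\<epsilon>. real (covering_number K \<epsilon>) * \<epsilon> powr d) \<longlongrightarrow> 0) (at_right 0) \<and>
           \<not> (\<exists>f :: nat \<Rightarrow> real \<Rightarrow> real ^ 2.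
                 (\<forall>i. holder_curve (1 / d) (f i)) \<and> K \<subseteq> (\<Union>i. f i ` {0..1}))"
proof -
  obtain r m P where "sparse_grids d r m P"
    using exists_sparse_grids[OF assms] by blast
  then interpret sparse_grids d r m P .
  have "hausdorff_dim K = 0"
    using hausdorff_dim_le_lower_box_dim[OF compact_K] hausdorff_dim_nonneg[of K]
    by (simp add: lower_box_dim_K)
  then show ?thesis
    using compact_K lower_box_dim_K covering_number_K_limit no_countable_holder_cover by blast
qed

end
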